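(* Fix integers $t\ge 0$ and $\ell=1$. Let $\mathbf{x},\mathbf{y}$ be sets of indeterminates, and for $n\ge0$, $i\in\{0,1\}$, let $a^{(i)}_n(\mathbf{x})\in\mathbb{R}[\mathbf{x}]$, $b_n(\mathbf{y})\in\mathbb{R}[\mathbf{y}]$ be polynomials with nonnegative coefficients. Let $M=[M_{n,k}]_{n,k\ge0}$ be the weighted lattice path matrix defined in the context. Then (i) $M$ is $(\mathbf{x},\mathbf{y})$-totally positive; (ii) if $t\ge1$, then for each $n\ge0$ the Toeplitz matrix $[M_{n,i-j}]_{i,j\ge0}$ of the $n$th row sequence $(M_{n,k})_{k\ge0}$ is $(\mathbf{x},\mathbf{y})$-totally positive (with $M_{n,k}=0$ for $k<0$).
   Context: For $n,k\ge0$, $M_{n,k}$ is the sum of the weights of all lattice paths in $\mathbb{N}^2$ from $(0,0)$ to $(k,n)$ using the steps $(0,1)$ and $(1,t+i)$ for $0\le i\le\ell$, where each step $(0,1)$ starting at height $n-1$ gets weight $b_n(\mathbf{y})$, each step $(1,t+i)$ starting at height $n-t-i$ gets weight $a^{(i)}_n(\mathbf{x})$, and the weight of a path is the product of the weights of its steps. For a set of indeterminates $\mathbf{z}$, a matrix with entries in $\mathbb{R}[\mathbf{z}]$ is $\mathbf{z}$-totally positive if all its minors are polynomials with nonnegative coefficients in $\mathbf{z}$. *)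

theory Defs
  imports
    "HOL-Library.Poly_Mapping"
    "HOL-Library.Product_Plus"
    "Jordan_Normal_Form.Determinant"
begin

type_synonym 'v rpoly = "('v \<Rightarrow>\<^sub>0 nat) \<Rightarrow>\<^sub>0 real"

definition polys_in :: "'v set \<Rightarrow> 'v rpoly set" where
  "polys_in Z = {p. \<forall>m \<in> Poly_Mapping.keys p. Poly_Mapping.keys m \<subseteq> Z}"

definition nonneg_coeffs :: "'v rpoly \<Rightarrow> bool" where
  "nonneg_coeffs p \<longleftrightarrow> (\<forall>m. Poly_Mapping.lookup p m \<ge> 0)"

definition minor :: "(nat \<Rightarrow> nat \<Rightarrow> 'a :: comm_ring_1) \<Rightarrow> nat \<Rightarrow> (nat \<Rightarrow> nat) \<Rightarrow> (nat \<Rightarrow> nat) \<Rightarrow> 'a" where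
  "minor A r f g = det (mat r r (\<lambda>(p, q). A (f p) (g q)))"

text \<open>The case \<open>r = 1\<close> includes the requirement that the entries lie in \<open>polys_in Z\<close>.\<close>

definition totally_positive :: "'v set \<Rightarrow> (nat \<Rightarrow> nat \<Rightarrow> 'v rpoly) \<Rightarrow> bool" where
  "totally_positive Z A \<longleftrightarrow>
     (\<forall>r f g. strict_mono_on {..<r} f \<longrightarrow> strict_mono_on {..<r} g \<longrightarrow>
        minor A r f g \<in> polys_in Z \<and> nonneg_coeffs (minor A r f g))"

definition toeplitz :: "(nat \<Rightarrow> 'a :: zero) \<Rightarrow> nat \<Rightarrow> nat \<Rightarrow> 'a" where
  "toeplitz u i j = (if j \<le> i then u (i - j) else 0)"

text \<open>
  A lattice path starting at the origin is given by its list of steps. All steps have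
  nonnegative coordinates, so such a path never leaves the quadrant.
\<close>

datatype lstep = Vert | Diag nat

fun step_vec :: "nat \<Rightarrow> lstep \<Rightarrow> nat \<times> nat" where
  "step_vec t Vert = (0, 1)"
| "step_vec t (Diag i) = (1, t + i)"

definition lattice_paths :: "nat \<Rightarrow> nat \<Rightarrow> nat \<times> nat \<Rightarrow> lstep list set" where
  "lattice_paths t l z =
     {w. set w \<subseteq> insert Vert (Diag ` {0..l}) \<and> (\<Sum>s\<leftarrow>w. step_vec t s) = z}"

text \<open>
  The weight of a step starting at height \<open>h\<close>. The index of \<open>a\<close> and \<open>b\<close> is the height at
  which the step ends: \<open>a i n\<close> belongs to the step \<open>(1, t + i)\<close> starting at height
  \<open>n - t - i\<close>, and \<open>b n\<close> to the step \<open>(0, 1)\<close> starting at height \<open>n - 1\<close>.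
\<close>

fun step_weight ::
  "nat \<Rightarrow> (nat \<Rightarrow> nat \<Rightarrow> 'a) \<Rightarrow> (nat \<Rightarrow> 'a) \<Rightarrow> nat \<Rightarrow> lstep \<Rightarrow> 'a" where
  "step_weight t a b h Vert = b (h + 1)"
| "step_weight t a b h (Diag i) = a i (h + t + i)"

fun path_weight ::
  "nat \<Rightarrow> (nat \<Rightarrow> nat \<Rightarrow> 'a :: comm_semiring_1) \<Rightarrow> (nat \<Rightarrow> 'a) \<Rightarrow> nat \<Rightarrow> lstep list \<Rightarrow> 'a" where
  "path_weight t a b h [] = 1"
| "path_weight t a b h (s # w) =
     step_weight t a b h s * path_weight t a b (h + snd (step_vec t s)) w"

definition path_matrix ::
  "nat \<Rightarrow> nat \<Rightarrow> (nat \<Rightarrow> nat \<Rightarrow> 'a :: comm_semiring_1) \<Rightarrow> (nat \<Rightarrow> 'a) \<Rightarrow> nat \<Rightarrow> nat \<Rightarrow> 'a" where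
  "path_matrix t l a b n k = (\<Sum>w \<in> lattice_paths t l (k, n). path_weight t a b 0 w)"

lemma length_le_sum_step_vec:
  "length w \<le> fst (\<Sum>s\<leftarrow>w. step_vec t s) + snd (\<Sum>s\<leftarrow>w. step_vec t s)"
proof (induction w)
  case (Cons s w)
  then show ?case by (cases s) auto
qed simp

text \<open>The sum defining \<open>path_matrix\<close> is therefore not degenerate.\<close>

lemma finite_lattice_paths: "finite (lattice_paths t l z)"
proof (rule finite_subset)
  show "lattice_paths t l z \<subseteq>
      {w. set w \<subseteq> insert Vert (Diag ` {0..l}) \<and> length w \<le> fst z + snd z}"
    unfolding lattice_paths_def using length_le_sum_step_vec by blast
  show "finite {w. set w \<subseteq> insert Vert (Diag ` {0..l}) \<and> length w \<le> fst z + snd z}"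
    by (rule finite_lists_length_le) simp
qed

end

theory Submission
  imports Defs
begin

text \<open>
  Cut the strip \<open>0 \<le> y \<le> N\<close> at abscissa \<open>c - 1\<close> and consider the weights of all paths from the bottom
  points \<open>(j, 0)\<close> to the points on the upper and right boundary of the cut strip, listed clockwise.
  Advancing the cut by one column first replaces each height row by a combination of two adjacent old
  rows (the steps \<open>(1, t)\<close> and \<open>(1, t + 1)\<close>), then adds a unit entry for the new source, and finally adds
  multiples of a row to the row next to it (the vertical steps). Each of these operations preserves
  total positivity, since expanding a minor by multilinearity produces only minors of the old matrix
  with weakly increasing row indices. The Toeplitz matrix of the row \<open>N\<close> consists of the rows on the upper
  boundary; the matrix \<open>M\<close> itself, with both index sets reversed, is read off the right boundary.
\<close>

subsection \<open>Determinants\<close>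

lemma mat_delete_mat:
  "mat_delete (mat (Suc r) (Suc r) F) i j =
     mat r r (\<lambda>(p, q). F (if p < i then p else Suc p, if q < j then q else Suc q))"
  by (rule eq_matI) (auto simp: mat_delete_def)

lemma cofactor_mat_cong:
  assumes "\<And>p q. p < r \<Longrightarrow> q < r \<Longrightarrow> p \<noteq> k \<Longrightarrow> F (p, q) = G (p, q)"
  shows "cofactor (mat r r F) k j = cofactor (mat r r G) k j"
proof -
  have "mat_delete (mat r r F) k j = mat_delete (mat r r G) k j"
    by (rule eq_matI) (use assms in \<open>auto simp: mat_delete_def\<close>)
  then show ?thesis
    by (simp add: cofactor_def)
qed

text \<open>Laplace expansion along row \<open>k\<close>: its cofactors do not see row
  \<open>k\<close>, so the three matrices share them.\<close>

lemma det_row_linear: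
  fixes F G H :: "nat \<times> nat \<Rightarrow> 'a :: comm_ring_1"
  assumes k: "k < r"
    and row: "\<And>q. q < r \<Longrightarrow> F (k, q) = x * G (k, q) + y * H (k, q)"
    and FG: "\<And>p q. p < r \<Longrightarrow> q < r \<Longrightarrow> p \<noteq> k \<Longrightarrow> F (p, q) = G (p, q)"
    and FH: "\<And>p q. p < r \<Longrightarrow> q < r \<Longrightarrow> p \<noteq> k \<Longrightarrow> F (p, q) = H (p, q)"
  shows "det (mat r r F) = x * det (mat r r G) + y * det (mat r r H)"
proof -
  have expand: "det (mat r r E) = (\<Sum>j<r. E (k, j) * cofactor (mat r r E) k j)"
    for E :: "nat \<times> nat \<Rightarrow> 'a"
    using k by (subst laplace_expansion_row[of _ r k]) auto
  have "det (mat r r F) = (\<Sum>j<r. (x * G (k, j) + y * H (k, j)) * cofactor (mat r r F) k j)"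
    using row by (subst expand) (auto intro!: sum.cong)
  also have "\<dots> = x * (\<Sum>j<r. G (k, j) * cofactor (mat r r F) k j)
      + y * (\<Sum>j<r. H (k, j) * cofactor (mat r r F) k j)"
    by (simp add: sum_distrib_left sum.distrib algebra_simps)
  also have "\<dots> = x * det (mat r r G) + y * det (mat r r H)"
    using cofactor_mat_cong[of r k F G] cofactor_mat_cong[of r k F H] FG FH
    by (simp add: expand[of G] expand[of H])
  finally show ?thesis .
qed

text \<open>Reversing the rows and reversing the columns contribute the same sign, whose square is
  1.\<close>

lemma det_reverse:
  fixes F :: "nat \<Rightarrow> nat \<Rightarrow> 'a :: comm_ring_1"
  shows "det (mat r r (\<lambda>(p, q). F (r - 1 - p) (r - 1 - q))) = det (mat r r (\<lambda>(p, q). F p q))"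
proof -
  define \<rho> where "\<rho> = (\<lambda>p. if p < r then r - 1 - p else p)"
  have perm: "\<rho> permutes {0..<r}"
    by (rule bij_imp_permutes, rule bij_betw_byWitness[where f' = \<rho>]) (auto simp: \<rho>_def)
  have sq: "signof \<rho> * signof \<rho> = (1 :: 'a)"
    by (simp add: sign_def)
  have rows: "det (mat r r (\<lambda>(p, q). E (\<rho> p) q)) = signof \<rho> * det (mat r r (\<lambda>(p, q). E p q))"
    for E :: "nat \<Rightarrow> nat \<Rightarrow> 'a"
  proof -
    have "mat r r (\<lambda>(p, q). E (\<rho> p) q) =
        mat r r (\<lambda>(p, q). mat r r (\<lambda>(p, q). E p q) $$ (\<rho> p, q))"
      by (rule eq_matI) (auto simp: \<rho>_def)
    then show ?thesis
      using det_permute_rows[OF _ perm, of "mat r r (\<lambda>(p, q). E p q)"] by simp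
  qed
  have transp: "det (mat r r (\<lambda>(p, q). E q p)) = det (mat r r (\<lambda>(p, q). E p q))"
    for E :: "nat \<Rightarrow> nat \<Rightarrow> 'a"
  proof -
    have "mat r r (\<lambda>(p, q). E q p) = (mat r r (\<lambda>(p, q). E p q))\<^sup>T"
      by (rule eq_matI) auto
    then show ?thesis
      using det_transpose[of "mat r r (\<lambda>(p, q). E p q)" r] by simp
  qed
  have "mat r r (\<lambda>(p, q). F (r - 1 - p) (r - 1 - q)) = mat r r (\<lambda>(p, q). F (\<rho> p) (\<rho> q))"
    by (rule eq_matI) (auto simp: \<rho>_def)
  then have "det (mat r r (\<lambda>(p, q). F (r - 1 - p) (r - 1 - q))) =
      signof \<rho> * det (mat r r (\<lambda>(p, q). F p (\<rho> q)))"
    using rows[of "\<lambda>p q. F p (\<rho> q)"] by simp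
  also have "\<dots> = signof \<rho> * (signof \<rho> * det (mat r r (\<lambda>(p, q). F p q)))"
    using transp[of "\<lambda>p q. F q (\<rho> p)"] rows[of "\<lambda>p q. F q p"] transp[of F] by simp
  finally show ?thesis
    by (simp add: mult.assoc[symmetric] sq)
qed

subsection \<open>Total positivity over a semiring of positive elements\<close>

text \<open>Minors need subtraction, hence the ambient ring; the arguments below only need the
  target set \<open>S\<close> of the minors to be closed under sums and products.\<close>

locale positive_cone =
  fixes S :: "'a :: comm_ring_1 set"
  assumes zero_closed [simp]: "0 \<in> S"
    and one_closed [simp]: "1 \<in> S"
    and add_closed: "x \<in> S \<Longrightarrow> y \<in> S \<Longrightarrow> x + y \<in> S"
    and mult_closed: "x \<in> S \<Longrightarrow> y \<in> S \<Longrightarrow> x * y \<in> S"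
begin

definition tp :: "(nat \<Rightarrow> nat \<Rightarrow> 'a) \<Rightarrow> bool" where
  "tp A \<longleftrightarrow> (\<forall>r f g. strict_mono_on {..<r} f \<longrightarrow> strict_mono_on {..<r} g \<longrightarrow> minor A r f g \<in> S)"

lemma tpD:
  "tp A \<Longrightarrow> strict_mono_on {..<r} f \<Longrightarrow> strict_mono_on {..<r} g \<Longrightarrow> minor A r f g \<in> S"
  by (auto simp: tp_def)

lemma tp_zero: "tp (\<lambda>_ _. 0)"
proof -
  have "minor (\<lambda>_ _. 0) r f g \<in> S" for r f g
  proof (cases r)
    case 0
    then show ?thesis by (simp add: minor_def)
  next
    case (Suc r')
    have "mat r r (\<lambda>(p, q). 0) = (0\<^sub>m r r :: 'a mat)"
      by (rule eq_matI) auto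
    with Suc show ?thesis by (simp add: minor_def)
  qed
  then show ?thesis by (simp add: tp_def)
qed

text \<open>A repeated index gives two equal rows and a zero minor; otherwise \<open>f\<close> is
  injective, hence strictly increasing.\<close>

lemma tp_minor_weak_mono:
  assumes A: "tp A" and f: "mono_on {..<r} f" and g: "strict_mono_on {..<r} g"
  shows "minor A r f g \<in> S"
proof (cases "inj_on f {..<r}")
  case True
  then have "strict_mono_on {..<r} f"
    using f unfolding strict_mono_on_def mono_on_def inj_on_def
    by (metis order.strict_iff_order)
  then show ?thesis
    using A g by (intro tpD)
next
  case False
  then obtain i j where ij: "i < r" "j < r" "i \<noteq> j" "f i = f j"
    by (auto simp: inj_on_def)
  then have "minor A r f g = 0"
    unfolding minor_def
    by (intro det_identical_rows[of _ r i j]) (auto intro!: eq_vecI)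
  then show ?thesis by simp
qed

text \<open>Serves both the diagonal and the vertical updates. The last two assumptions make every
  choice between \<open>u p\<close> and \<open>v p\<close> weakly increasing in
  \<open>p\<close>.\<close>

lemma tp_two_rows:
  assumes B: "tp B"
    and coeffs: "\<And>p. \<alpha> p \<in> S" "\<And>p. \<beta> p \<in> S"
    and rows: "\<And>p j. A p j = \<alpha> p * B (u p) j + \<beta> p * B (v p) j"
    and uv: "\<And>p. u p \<le> v p" and vu: "\<And>p q. p < q \<Longrightarrow> v p \<le> u q"
  shows "tp A"
proof -
  \<comment> \<open>A stage of the multilinear expansion: rows before \<open>k\<close> are still
    rows of \<open>A\<close>, the others are already chosen rows of \<open>B\<close>. At
    \<open>k = r\<close> this is the minor of \<open>A\<close>.\<close>
  have mixed: "det (mat r r (\<lambda>(p, q). if p < k then A (f p) (g q) else B (s p) (g q))) \<in> S"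
    if f: "strict_mono_on {..<r} f" and g: "strict_mono_on {..<r} g"
      and "k \<le> r" "\<And>p. s p \<in> {u (f p), v (f p)}" for r f g k s
    using that(3,4)
  proof (induction k arbitrary: s)
    case 0
    have "mono_on {..<r} s"
    proof (rule mono_onI)
      fix p q assume pq: "p \<in> {..<r}" "q \<in> {..<r}" "p \<le> q"
      show "s p \<le> s q"
      proof (cases "p = q")
        case False
        then have "f p < f q"
          using pq f by (auto simp: strict_mono_on_def)
        then have "v (f p) \<le> u (f q)"
          by (rule vu)
        then show ?thesis
          using 0(2)[of p] 0(2)[of q] uv[of "f p"] uv[of "f q"] by auto
      qed simp
    qed
    then show ?case
      using tp_minor_weak_mono[OF B _ g] by (simp add: minor_def)
  next
    case (Suc k)
    let ?D = "\<lambda>s. mat r r (\<lambda>(p, q). if p < k then A (f p) (g q) else B (s p) (g q))"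
    have "det (mat r r (\<lambda>(p, q). if p < Suc k then A (f p) (g q) else B (s p) (g q)))
        = \<alpha> (f k) * det (?D (s(k := u (f k)))) + \<beta> (f k) * det (?D (s(k := v (f k))))"
      using Suc.prems(1) by (intro det_row_linear[of k]) (auto simp: rows)
    moreover have "det (?D (s(k := u (f k)))) \<in> S" "det (?D (s(k := v (f k)))) \<in> S"
      by (intro Suc.IH; use Suc.prems in auto)+
    ultimately show ?case
      using coeffs by (auto intro!: add_closed mult_closed)
  qed
  show ?thesis
    unfolding tp_def
  proof (intro allI impI)
    fix r f g assume fg: "strict_mono_on {..<r} (f :: nat \<Rightarrow> nat)" "strict_mono_on {..<r} (g :: nat \<Rightarrow> nat)"
    have "mat r r (\<lambda>(p, q). if p < r then A (f p) (g q) else B (u (f p)) (g q)) =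
        mat r r (\<lambda>(p, q). A (f p) (g q))"
      by (rule eq_matI) auto
    then show "minor A r f g \<in> S"
      using mixed[OF fg, of r "\<lambda>p. u (f p)"] by (simp add: minor_def)
  qed
qed

text \<open>The new 1 is at the bottom right corner of the nonzero part. A minor containing it in
  its last diagonal position reduces, with positive sign, to a smaller minor of
  \<open>B\<close>.\<close>

lemma tp_unit_column:
  assumes B: "tp B"
    and zero_col: "\<And>i j. C \<le> j \<Longrightarrow> B i j = 0" and zero_row: "\<And>i j. R < i \<Longrightarrow> B i j = 0"
  shows "tp (\<lambda>i j. B i j + (if i = R \<and> j = C then 1 else 0))"
proof -
  define A where "A = (\<lambda>i j. B i j + (if i = R \<and> j = C then 1 else 0))"
  have "minor A r f g \<in> S" if f: "strict_mono_on {..<r} f" and g: "strict_mono_on {..<r} g" for r f g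
  proof (cases r)
    case 0
    then show ?thesis by (simp add: minor_def)
  next
    case (Suc m)
    have g_less: "g q < g m" if "q < m" for q
      using g that Suc by (auto simp: strict_mono_on_def)
    have f_less: "f q < f m" if "q < m" for q
      using f that Suc by (auto simp: strict_mono_on_def)
    let ?M = "mat r r (\<lambda>(p, q). A (f p) (g q))"
    show ?thesis
    proof (cases "g m < C")
      case True
      then have "g q < C" if "q < r" for q
        using g_less[of q] that Suc by (cases "q = m") auto
      then have "?M = mat r r (\<lambda>(p, q). B (f p) (g q))"
        by (intro cong_mat) (auto simp: A_def)
      then show ?thesis
        using tpD[OF B f g] by (simp add: minor_def)
    next
      case False
      have expand: "det ?M = (\<Sum>i<r. A (f i) (g m) * cofactor ?M i m)"
        using Suc by (subst laplace_expansion_column[of _ r m]) auto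
      have entry: "A (f i) (g m) = (if f i = R \<and> g m = C then 1 else 0)" for i
        using False by (simp add: A_def zero_col)
      \<comment> \<open>Respectively: a 1 in the corner, a zero last row, a zero last
        column.\<close>
      consider "f m = R" "g m = C" | "R < f m" | "f m \<le> R" "f m \<noteq> R \<or> g m \<noteq> C"
        by linarith
      then show ?thesis
      proof cases
        case 1
        have "det ?M = (\<Sum>i\<in>{m}. A (f i) (g m) * cofactor ?M i m)"
          unfolding expand
        proof (rule sum.mono_neutral_right)
          show "\<forall>i\<in>{..<r} - {m}. A (f i) (g m) * cofactor ?M i m = 0"
          proof
            fix i assume "i \<in> {..<r} - {m}"
            then have "f i < f m"
              using f_less Suc by auto
            then show "A (f i) (g m) * cofactor ?M i m = 0"
              using 1 entry[of i] by simp
          qed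
        qed (use Suc in auto)
        also have "\<dots> = cofactor ?M m m"
          using 1 entry[of m] by simp
        also have "\<dots> = det (mat m m (\<lambda>(p, q). A (f p) (g q)))"
        proof -
          have "mat_delete ?M m m = mat m m (\<lambda>(p, q). A (f p) (g q))"
            unfolding Suc mat_delete_mat by (rule eq_matI) auto
          then show ?thesis by (simp add: cofactor_def)
        qed
        also have "mat m m (\<lambda>(p, q). A (f p) (g q)) = mat m m (\<lambda>(p, q). B (f p) (g q))"
          using g_less 1 by (intro cong_mat) (auto simp: A_def dest: less_imp_neq)
        also have "det \<dots> \<in> S"
          using tpD[OF B, of m f g] f g Suc
          by (auto simp: minor_def strict_mono_on_def)
        finally show ?thesis by (simp add: minor_def)
      next
        case 2
        have "det ?M = (\<Sum>j<r. A (f m) (g j) * cofactor ?M m j)"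
          using Suc by (subst laplace_expansion_row[of _ r m]) auto
        also have "\<dots> = 0"
          using 2 by (intro sum.neutral) (auto simp: A_def zero_row)
        finally show ?thesis by (simp add: minor_def)
      next
        case 3
        have "f i \<noteq> R \<or> g m \<noteq> C" if "i < r" for i
          using 3 f_less[of i] that Suc by (cases "i = m") auto
        then have "det ?M = 0"
          unfolding expand by (intro sum.neutral) (auto simp: entry)
        then show ?thesis by (simp add: minor_def)
      qed
    qed
  qed
  then show ?thesis by (simp add: tp_def A_def)
qed

end

subsection \<open>The recurrence for the path matrix\<close>

lemma path_weight_append:
  "path_weight t a b h (w @ w') =
     path_weight t a b h w * path_weight t a b (h + snd (\<Sum>s\<leftarrow>w. step_vec t s)) w'"
  by (induction w arbitrary: h) (simp_all add: mult.assoc add.assoc)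

lemma lattice_paths_snoc:
  assumes "s \<in> insert Vert (Diag ` {0..l})"
  shows "w @ [s] \<in> lattice_paths t l (k, n) \<longleftrightarrow>
    fst (step_vec t s) \<le> k \<and> snd (step_vec t s) \<le> n \<and>
    w \<in> lattice_paths t l (k - fst (step_vec t s), n - snd (step_vec t s))"
  using assms by (auto simp: lattice_paths_def prod_eq_iff)

lemma sum_paths_last_step:
  assumes s: "s \<in> insert Vert (Diag ` {0..l})" and v: "step_vec t s = (c, d)"
  shows "(\<Sum>w\<in>{w. w @ [s] \<in> lattice_paths t l (k, n)}. path_weight t a b 0 (w @ [s])) =
    (if c \<le> k \<and> d \<le> n then step_weight t a b (n - d) s * path_matrix t l a b (n - d) (k - c) else 0)"
proof (cases "c \<le> k \<and> d \<le> n")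
  case True
  have "(\<Sum>w\<in>{w. w @ [s] \<in> lattice_paths t l (k, n)}. path_weight t a b 0 (w @ [s])) =
      (\<Sum>w\<in>lattice_paths t l (k - c, n - d). path_weight t a b 0 (w @ [s]))"
    using True v by (simp add: lattice_paths_snoc[OF s])
  also have "\<dots> = (\<Sum>w\<in>lattice_paths t l (k - c, n - d). step_weight t a b (n - d) s * path_weight t a b 0 w)"
    by (rule sum.cong) (auto simp: path_weight_append lattice_paths_def mult.commute)
  finally show ?thesis
    using True by (simp add: path_matrix_def sum_distrib_left)
next
  case False
  then show ?thesis
    using v by (auto simp: lattice_paths_snoc[OF s])
qed

text \<open>Nonempty paths are classified by their last step, which ends at height \<open>n\<close>
  and so has weight index \<open>n\<close>. The guards exclude starting points that truncated
  subtraction would wrongly supply.\<close>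

lemma path_matrix_rec:
  "path_matrix t 1 a b n k =
     (if n = 0 \<and> k = 0 then 1 else 0)
     + (if 1 \<le> n then b n * path_matrix t 1 a b (n - 1) k else 0)
     + (if 1 \<le> k \<and> t \<le> n then a 0 n * path_matrix t 1 a b (n - t) (k - 1) else 0)
     + (if 1 \<le> k \<and> t + 1 \<le> n then a 1 n * path_matrix t 1 a b (n - (t + 1)) (k - 1) else 0)"
proof -
  let ?L = "lattice_paths t 1 (k, n)"
  let ?W = "path_weight t a b 0"
  define P where "P = (\<lambda>s. (\<lambda>w. w @ [s]) ` {w. w @ [s] \<in> ?L})"
  have steps: "insert Vert (Diag ` {0..1}) = {Vert, Diag 0, Diag 1}"
  proof -
    have "{0..1} = {0, 1 :: nat}" by auto
    then show ?thesis by simp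
  qed
  have "?L = (?L \<inter> {[]}) \<union> (P Vert \<union> (P (Diag 0) \<union> P (Diag 1)))"
  proof (intro equalityI subsetI)
    fix w assume w: "w \<in> ?L"
    show "w \<in> (?L \<inter> {[]}) \<union> (P Vert \<union> (P (Diag 0) \<union> P (Diag 1)))"
    proof (cases w rule: rev_cases)
      case (snoc w' s)
      then have "s \<in> {Vert, Diag 0, Diag 1}"
        using w steps by (auto simp: lattice_paths_def)
      then show ?thesis
        using w snoc by (auto simp: P_def)
    qed (use w in simp)
  qed (auto simp: P_def)
  moreover have fin: "finite (P s)" for s
    by (rule finite_subset[OF _ finite_lattice_paths[of t 1 "(k, n)"]]) (auto simp: P_def)
  moreover have "finite (?L \<inter> {[]})"
    by simp
  moreover have "(?L \<inter> {[]}) \<inter> (P Vert \<union> (P (Diag 0) \<union> P (Diag 1))) = {}"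
    "P Vert \<inter> (P (Diag 0) \<union> P (Diag 1)) = {}" "P (Diag 0) \<inter> P (Diag 1) = {}"
    by (auto simp: P_def)
  ultimately have split: "sum ?W ?L =
      sum ?W (?L \<inter> {[]}) + (sum ?W (P Vert) + (sum ?W (P (Diag 0)) + sum ?W (P (Diag 1))))"
    by (metis (no_types, lifting) sum.union_disjoint finite_UnI)
  have last: "sum ?W (P s) = (\<Sum>w\<in>{w. w @ [s] \<in> ?L}. ?W (w @ [s]))" for s
    unfolding P_def by (subst sum.reindex) (auto simp: inj_on_def)
  have "?L \<inter> {[]} = (if n = 0 \<and> k = 0 then {[]} else {})"
    by (auto simp: lattice_paths_def zero_prod_def)
  then have "sum ?W (?L \<inter> {[]}) = (if n = 0 \<and> k = 0 then 1 else 0)"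
    by simp
  moreover have "sum ?W (P Vert) = (if 1 \<le> n then b n * path_matrix t 1 a b (n - 1) k else 0)"
    unfolding last by (subst sum_paths_last_step) auto
  moreover have "sum ?W (P (Diag 0)) =
      (if 1 \<le> k \<and> t \<le> n then a 0 n * path_matrix t 1 a b (n - t) (k - 1) else 0)"
    unfolding last by (subst sum_paths_last_step) auto
  moreover have "sum ?W (P (Diag 1)) =
      (if 1 \<le> k \<and> t + 1 \<le> n then a 1 n * path_matrix t 1 a b (n - (t + 1)) (k - 1) else 0)"
    unfolding last by (subst sum_paths_last_step) auto
  ultimately show ?thesis
    using split by (simp add: path_matrix_def add.assoc)
qed

subsection \<open>Sweeping the strip column by column\<close>

context
  fixes t :: nat and a :: "nat \<Rightarrow> nat \<Rightarrow> 'a :: comm_ring_1" and b :: "nat \<Rightarrow> 'a" and N :: nat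
begin

text \<open>
  The weight of the paths from \<open>(j, 0)\<close> to \<open>(c - 1, N - s)\<close>: rows are numbered by their depth below
  height \<open>N\<close>, and the last column reached so far is \<open>c - 1\<close>.
\<close>

definition depth_row :: "nat \<Rightarrow> nat \<Rightarrow> nat \<Rightarrow> 'a" where
  "depth_row c s j = (if s \<le> N \<and> j < c then path_matrix t 1 a b (N - s) (c - 1 - j) else 0)"

text \<open>
  The columns are the sources \<open>(0, 0), (1, 0), \<dots>\<close>. The rows are the sinks
  \<open>(0, N), \<dots>, (c - 1, N), (c - 1, N - 1), \<dots>, (c - 1, 0)\<close>, i.e. the upper and right boundary of the
  strip up to abscissa \<open>c - 1\<close>, followed by zero rows.
\<close>

definition sweep :: "nat \<Rightarrow> nat \<Rightarrow> nat \<Rightarrow> 'a" where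
  "sweep c r j = (if r < c then toeplitz (path_matrix t 1 a b N) r j else depth_row c (r + 1 - c) j)"

text \<open>Paths entering column \<open>c\<close> by a diagonal step: a rise of \<open>t\<close> or
  \<open>t + 1\<close> means a start that much deeper in column \<open>c - 1\<close>.\<close>

definition diag_rows :: "nat \<Rightarrow> nat \<Rightarrow> nat \<Rightarrow> 'a" where
  "diag_rows c s j = a 0 (N - s) * depth_row c (s + t) j + a 1 (N - s) * depth_row c (s + t + 1) j"

text \<open>In the new column \<open>c\<close>, the vertical steps are taken into account only below height \<open>m\<close>.\<close>

definition partial_sweep :: "nat \<Rightarrow> nat \<Rightarrow> nat \<Rightarrow> nat \<Rightarrow> 'a" where
  "partial_sweep c m r j =
     (if r < c then toeplitz (path_matrix t 1 a b N) r j
      else if N < r - c + m then depth_row (c + 1) (r - c) j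
      else diag_rows c (r - c) j)"

text \<open>This is \<open>path_matrix_rec\<close> in depth coordinates: the isolated 1 is the
  source \<open>(c, 0)\<close>, and a vertical step comes from one unit deeper.\<close>

lemma depth_row_rec:
  "depth_row (c + 1) s j =
     (if s = N \<and> j = c then 1 else 0) + b (N - s) * depth_row (c + 1) (s + 1) j + diag_rows c s j"
proof (cases "s \<le> N \<and> j \<le> c")
  case False
  then show ?thesis by (auto simp: depth_row_def diag_rows_def)
next
  case True
  have [simp]: "N - s - (t + 1) = N - (s + t + 1)" "N - s - t = N - (s + t)" "N - s - 1 = N - (s + 1)"
    by auto
  have [simp]: "c - j - 1 = c - 1 - j" by simp
  show ?thesis
    using True
    by (subst depth_row_def, simp only: add_diff_cancel_right', subst path_matrix_rec)
       (auto simp: depth_row_def diag_rows_def)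
qed

lemma rows_below_eq_0:
  assumes "N < s"
  shows "depth_row c s j = 0" "diag_rows c s j = 0"
  using assms by (simp_all add: depth_row_def diag_rows_def)

lemma sweep_eq_toeplitz: "r < c \<Longrightarrow> sweep c r j = toeplitz (path_matrix t 1 a b N) r j"
  by (simp add: sweep_def)

text \<open>The case \<open>r = c - 1\<close> is the corner \<open>(c - 1, N)\<close>, where the
  upper and right boundaries meet and both descriptions agree.\<close>

lemma sweep_eq_depth_row:
  assumes "c \<le> r + 1"
  shows "sweep c r j = depth_row c (r + 1 - c) j"
proof (cases "r < c")
  case True
  with assms have "c = Suc r" by simp
  then show ?thesis
    by (auto simp: sweep_def depth_row_def toeplitz_def)
qed (simp add: sweep_def)

lemma partial_sweep_last: "partial_sweep c (N + 1) = sweep (c + 1)"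
proof (intro ext)
  fix r j
  show "partial_sweep c (N + 1) r j = sweep (c + 1) r j"
    using sweep_eq_depth_row[of "c + 1" r j] by (auto simp: partial_sweep_def sweep_eq_toeplitz)
qed

text \<open>No vertical step ends at height 0, so only the unit entry of the source
  \<open>(c, 0)\<close> appears, in row \<open>c + N\<close>.\<close>

lemma partial_sweep_first:
  "partial_sweep c 1 r j = partial_sweep c 0 r j + (if r = c + N \<and> j = c then 1 else 0)"
proof -
  consider "r < c" | "c \<le> r" "r - c < N" | "r = c + N" | "c + N < r"
    by linarith
  then show ?thesis
  proof cases
    case 3
    have "depth_row (c + 1) (N + 1) j = 0"
      by (simp add: depth_row_def)
    with 3 show ?thesis
      using depth_row_rec[of c N j] by (simp add: partial_sweep_def)
  qed (auto simp: partial_sweep_def)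
qed

text \<open>Only the row at height \<open>m\<close> changes: it gains \<open>b m\<close> times the
  row below, already complete at stage \<open>m\<close>. The other rows are padded with a zero term
  to fit \<open>tp_two_rows\<close>.\<close>

lemma partial_sweep_Suc:
  assumes m: "1 \<le> m" "m \<le> N"
  shows "partial_sweep c (Suc m) r j =
    1 * partial_sweep c m r j +
    (if r = c + (N - m) then b m else 0) * partial_sweep c m (if r = c + (N - m) then r + 1 else r) j"
proof (cases "r = c + (N - m)")
  case True
  define s where "s = N - m"
  have s: "\<not> r < c" "r - c = s" "r + 1 - c = s + 1" "N - s = m"
      "N < s + Suc m" "\<not> N < s + m" "N < s + 1 + m" "s \<noteq> N"
    using m True by (auto simp: s_def)
  have "partial_sweep c (Suc m) r j = depth_row (c + 1) s j"
    using s by (simp add: partial_sweep_def)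
  also have "\<dots> = diag_rows c s j + b m * depth_row (c + 1) (s + 1) j"
    using s depth_row_rec[of c s j] by simp
  also have "diag_rows c s j = partial_sweep c m r j"
    using s by (simp add: partial_sweep_def)
  also have "depth_row (c + 1) (s + 1) j = partial_sweep c m (r + 1) j"
    using s by (simp add: partial_sweep_def)
  finally show ?thesis
    using True by simp
next
  case False
  then show ?thesis
    using m by (auto simp: partial_sweep_def)
qed

lemma tp_sweep:
  assumes "positive_cone S"
    and a: "\<And>i n. i \<in> {0, 1} \<Longrightarrow> a i n \<in> S" and b: "\<And>n. b n \<in> S"
  shows "positive_cone.tp S (sweep c)"
proof -
  interpret positive_cone S by fact
  show ?thesis
  proof (induction c)
    case 0
    have "sweep 0 = (\<lambda>_ _. 0)"
      by (intro ext) (simp add: sweep_def depth_row_def)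
    then show ?case by (simp add: tp_zero)
  next
    case (Suc c)
    \<comment> \<open>Depth \<open>s\<close> in the old column is row \<open>c - 1 + s\<close> of
      \<open>sweep c\<close>, whence the indices \<open>p + t - 1\<close> and \<open>p + t\<close>.
      For \<open>c = 0\<close> the former may truncate, but then all old rows vanish.\<close>
    have first: "tp (partial_sweep c 0)"
    proof (rule tp_two_rows[OF Suc.IH])
      fix p j
      have "depth_row c (p - c + t) j = sweep c (p + t - 1) j" if "c \<le> p"
      proof (cases "c = 0")
        case False
        with that show ?thesis
          using sweep_eq_depth_row[of c "p + t - 1" j] by simp
      qed (simp add: sweep_def depth_row_def)
      moreover have "depth_row c (p - c + t + 1) j = sweep c (p + t) j" if "c \<le> p"
        using that sweep_eq_depth_row[of c "p + t" j] by (simp add: Suc_diff_le)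
      moreover have "depth_row (c + 1) (p - c) j = 0" "diag_rows c (p - c) j = 0" if "N < p - c"
        using that by (rule rows_below_eq_0)+
      ultimately show "partial_sweep c 0 p j =
          (if p < c then 1 else a 0 (N - (p - c))) * sweep c (if p < c then p else p + t - 1) j +
          (if p < c then 0 else a 1 (N - (p - c))) * sweep c (if p < c then p else p + t) j"
        by (auto simp: partial_sweep_def diag_rows_def sweep_eq_toeplitz)
    qed (use a in auto)
    have "tp (partial_sweep c (Suc m))" if "m \<le> N" for m
      using that
    proof (induction m)
      case 0
      have "tp (\<lambda>r j. partial_sweep c 0 r j + (if r = c + N \<and> j = c then 1 else 0))"
        by (rule tp_unit_column[OF first])
          (auto simp: partial_sweep_def toeplitz_def depth_row_def diag_rows_def)
      then show ?case
        using partial_sweep_first by simp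
    next
      case (Suc m)
      show ?case
      \<comment> \<open>Interlacing holds because adding the next row moves an index up by at most
        1.\<close>
      proof (rule tp_two_rows[where u = "\<lambda>r. r" and \<alpha> = "\<lambda>_. 1"])
        show "tp (partial_sweep c (Suc m))"
          using Suc by simp
        show "partial_sweep c (Suc (Suc m)) r j = 1 * partial_sweep c (Suc m) r j +
            (if r = c + (N - Suc m) then b (Suc m) else 0) *
              partial_sweep c (Suc m) (if r = c + (N - Suc m) then r + 1 else r) j" for r j
          using Suc.prems by (intro partial_sweep_Suc) auto
      qed (use b in auto)
    qed
    from this[of N] show ?case
      using partial_sweep_last[of c] by simp
  qed
qed

end

subsection \<open>Polynomials with nonnegative coefficients\<close>

lemma positive_cone_nonneg_polys:
  "positive_cone {p :: 'v rpoly. p \<in> polys_in Z \<and> nonneg_coeffs p}"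
proof
  fix p q :: "'v rpoly"
  assume "p \<in> {p. p \<in> polys_in Z \<and> nonneg_coeffs p}" and "q \<in> {p. p \<in> polys_in Z \<and> nonneg_coeffs p}"
  then have p: "\<forall>m\<in>Poly_Mapping.keys p. Poly_Mapping.keys m \<subseteq> Z" "\<And>m. Poly_Mapping.lookup p m \<ge> 0"
    and q: "\<forall>m\<in>Poly_Mapping.keys q. Poly_Mapping.keys m \<subseteq> Z" "\<And>m. Poly_Mapping.lookup q m \<ge> 0"
    by (auto simp: polys_in_def nonneg_coeffs_def)
  show "p + q \<in> {p. p \<in> polys_in Z \<and> nonneg_coeffs p}"
    using p q Poly_Mapping.keys_add[of p q] by (fastforce simp: polys_in_def nonneg_coeffs_def lookup_add)
  have "Poly_Mapping.keys m \<subseteq> Z" if m: "m \<in> Poly_Mapping.keys (p * q)" for m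
  proof -
    obtain m1 m2 where "m = m1 + m2" "m1 \<in> Poly_Mapping.keys p" "m2 \<in> Poly_Mapping.keys q"
      using keys_mult[of p q] m by blast
    then show ?thesis
      using p(1) q(1) Poly_Mapping.keys_add[of m1 m2] by blast
  qed
  moreover have "Poly_Mapping.lookup (p * q) m \<ge> 0" for m
    unfolding lookup_mult Sum_any.expand_set
    by (auto intro!: sum_nonneg mult_nonneg_nonneg p(2) q(2) simp: when_def)
  ultimately show "p * q \<in> {p. p \<in> polys_in Z \<and> nonneg_coeffs p}"
    by (auto simp: polys_in_def nonneg_coeffs_def)
qed (auto simp: polys_in_def nonneg_coeffs_def lookup_one when_def)

section \<open>Reading both matrices off the sweep\<close>

theorem theorem1p4:
  fixes t :: nat
    and X Y :: "'v set"
    and a :: "nat \<Rightarrow> nat \<Rightarrow> 'v rpoly"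
    and b :: "nat \<Rightarrow> 'v rpoly"
  assumes "\<And>i n. i \<in> {0, 1} \<Longrightarrow> a i n \<in> polys_in X \<and> nonneg_coeffs (a i n)"
    and "\<And>n. b n \<in> polys_in Y \<and> nonneg_coeffs (b n)"
  defines "M \<equiv> path_matrix t 1 a b"
  shows "totally_positive (X \<union> Y) M \<and>
    (t \<ge> 1 \<longrightarrow> (\<forall>n. totally_positive (X \<union> Y) (toeplitz (M n))))"
proof -
  define S where "S = {p :: 'v rpoly. p \<in> polys_in (X \<union> Y) \<and> nonneg_coeffs p}"
  interpret positive_cone S
    unfolding S_def by (rule positive_cone_nonneg_polys)
  have tp_iff: "totally_positive (X \<union> Y) A \<longleftrightarrow> tp A" for A
    unfolding totally_positive_def tp_def by (simp add: S_def)
  have tp: "tp (sweep t a b N c)" for N c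
  proof (rule tp_sweep)
    show "positive_cone S" ..
    show "a i n \<in> S" if "i \<in> {0, 1}" for i n
      using assms(1)[OF that, of n] by (auto simp: S_def polys_in_def)
    show "b n \<in> S" for n
      using assms(2)[of n] by (auto simp: S_def polys_in_def)
  qed
  \<comment> \<open>A minor uses finitely many indices, so a strip of finite height and width
    contains it.\<close>
  have bound: "\<exists>c. \<forall>p<r. f p < c" for r and f :: "nat \<Rightarrow> nat"
    using finite_nat_set_iff_bounded[of "f ` {..<r}"] by auto
  have "minor M r f g \<in> S" if f: "strict_mono_on {..<r} f" and g: "strict_mono_on {..<r} g" for r f g
  proof -
    obtain N where N: "\<forall>p<r. f p < N"
      using bound[of r f] by blast
    obtain c where c: "\<forall>p<r. g p < c"
      using bound[of r g] by blast
    \<comment> \<open>Row \<open>c - 1 + (N - n)\<close> of the sweep ends at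
      \<open>(c - 1, n)\<close> and column \<open>c - 1 - k\<close> starts \<open>k\<close> units to
      its left, so the entry is \<open>M n k\<close>. Both assignments reverse order;
      \<open>r - 1 - p\<close> restores it.\<close>
    define f' where "f' = (\<lambda>p. c - 1 + (N - f (r - 1 - p)))"
    define g' where "g' = (\<lambda>q. c - 1 - g (r - 1 - q))"
    have f': "strict_mono_on {..<r} f'"
    proof (rule strict_mono_onI)
      fix p q assume "p \<in> {..<r}" "q \<in> {..<r}" "p < q"
      then have "f (r - 1 - q) < f (r - 1 - p)" "f (r - 1 - p) < N"
        using f N by (auto simp: strict_mono_on_def)
      then show "f' p < f' q" by (simp add: f'_def)
    qed
    have g': "strict_mono_on {..<r} g'"
    proof (rule strict_mono_onI)
      fix p q assume "p \<in> {..<r}" "q \<in> {..<r}" "p < q"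
      then have "g (r - 1 - q) < g (r - 1 - p)" "g (r - 1 - p) < c"
        using g c by (auto simp: strict_mono_on_def)
      then show "g' p < g' q" by (simp add: g'_def)
    qed
    have "mat r r (\<lambda>(p, q). sweep t a b N c (f' p) (g' q)) =
        mat r r (\<lambda>(p, q). M (f (r - 1 - p)) (g (r - 1 - q)))"
    proof (rule eq_matI; clarsimp)
      fix p q assume "p < r" "q < r"
      then have "f (r - 1 - p) < N" "g (r - 1 - q) < c"
        using N c by auto
      then show "sweep t a b N c (f' p) (g' q) = M (f (r - Suc p)) (g (r - Suc q))"
        by (simp add: sweep_eq_depth_row f'_def g'_def depth_row_def M_def)
    qed
    then have "minor M r f g = minor (sweep t a b N c) r f' g'"
      using det_reverse[of r "\<lambda>p q. M (f p) (g q)"] by (simp add: minor_def)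
    then show ?thesis
      using tpD[OF tp f' g'] by simp
  qed
  then have "tp M"
    by (simp add: tp_def)
  moreover have "minor (toeplitz (M n)) r f g \<in> S"
    if f: "strict_mono_on {..<r} f" and g: "strict_mono_on {..<r} g" for n r f g
  proof -
    obtain c where c: "\<forall>p<r. f p < c"
      using bound[of r f] by blast
    \<comment> \<open>With strip height \<open>n\<close> and \<open>c\<close> beyond all chosen
      rows, only sinks on the upper boundary occur.\<close>
    have "mat r r (\<lambda>(p, q). toeplitz (M n) (f p) (g q)) = mat r r (\<lambda>(p, q). sweep t a b n c (f p) (g q))"
      by (rule eq_matI) (use c in \<open>auto simp: sweep_eq_toeplitz M_def\<close>)
    then show ?thesis
      using tpD[OF tp[of n c] f g] by (simp add: minor_def)
  qed
  then have "tp (toeplitz (M n))" for n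
    by (simp add: tp_def)
  ultimately show ?thesis
    by (simp add: tp_iff)
qed

end
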